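(* Let $\mathfrak{g}$ be a $6$-dimensional real nilpotent Lie algebra with a complex structure $J$. Then there exists a basis $\{e^1,\dots,e^6\}$ of $\mathfrak{g}^*$ satisfying $de^3\in\langle e^{12}\rangle$, $de^4\in\langle e^{12},e^{13},e^{23}\rangle$, $de^5\in\langle e^{12},e^{13},e^{14},e^{23},e^{24},e^{34}\rangle$, $de^6\in\langle e^{12},e^{13},e^{14},e^{15},e^{23},e^{24},e^{25},e^{34}\rangle$, such that either (I) $\omega^1=e^1+ie^2$, $\omega^2=e^3+ie^4$, $\omega^3=e^5+ie^6$, or (II) $\omega^1=e^1+ie^2$, $\omega^2=e^4+ie^5$, $\omega^3=e^3+ie^6$ is a basis of $\Lambda^{1,0}$ satisfying $d\omega^1=0$, $d\omega^2\in I(\omega^1)$, $d\omega^3\in I(\omega^1,\omega^2)$, so that $d\omega^1=0$, $\omega^1\wedge d\omega^2=0$ and $\omega^1\wedge\omega^2\wedge d\omega^3=0$.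
   Context: A complex structure is a linear $J\colon\mathfrak{g}\to\mathfrak{g}$ with $J^2=-1$ and $[JX,JY]=[X,Y]+J[JX,Y]+J[X,JY]$ for all $X,Y$. $d\alpha(X,Y)=-\alpha([X,Y])$, extended complex-linearly and as an antiderivation to $\Lambda^\bullet\mathfrak{g}^*_{\mathbb{C}}$; $\Lambda^{1,0}$ is the space of complex-linear forms $\omega$ on $\mathfrak{g}$ with $\omega(JX)=i\,\omega(X)$. $e^{ij}=e^i\wedge e^j$, and $I(\cdots)$ denotes the ideal generated in the complexified exterior algebra $\Lambda^\bullet\mathfrak{g}^*_{\mathbb{C}}$. *)

theory Defs
  imports "HOL-Analysis.Analysis"
begin

definition lie_algebra :: "('g::real_vector \<Rightarrow> 'g \<Rightarrow> 'g) \<Rightarrow> bool" where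
  "lie_algebra br \<longleftrightarrow> bilinear br \<and> (\<forall>x y. br x y = - br y x) \<and>
     (\<forall>x y z. br x (br y z) + br y (br z x) + br z (br x y) = 0)"

fun lower_central :: "('g::real_vector \<Rightarrow> 'g \<Rightarrow> 'g) \<Rightarrow> nat \<Rightarrow> 'g set" where
  "lower_central br 0 = UNIV"
| "lower_central br (Suc k) = span {br x y | x y. y \<in> lower_central br k}"

definition nilpotent_lie :: "('g::real_vector \<Rightarrow> 'g \<Rightarrow> 'g) \<Rightarrow> bool" where
  "nilpotent_lie br \<longleftrightarrow> (\<exists>k. lower_central br k = {0})"

definition complex_structure :: "('g::real_vector \<Rightarrow> 'g \<Rightarrow> 'g) \<Rightarrow> ('g \<Rightarrow> 'g) \<Rightarrow> bool" where
  "complex_structure br J \<longleftrightarrow> linear J \<and> (\<forall>X. J (J X) = - X) \<and>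
     (\<forall>X Y. br (J X) (J Y) = br X Y + J (br (J X) Y) + J (br X (J Y)))"

definition d1 :: "('g \<Rightarrow> 'g \<Rightarrow> 'g) \<Rightarrow> ('g \<Rightarrow> 'a::ab_group_add) \<Rightarrow> 'g \<Rightarrow> 'g \<Rightarrow> 'a" where
  "d1 br \<alpha> = (\<lambda>X Y. - \<alpha> (br X Y))"

definition wedge11 :: "('g \<Rightarrow> 'a::comm_ring) \<Rightarrow> ('g \<Rightarrow> 'a) \<Rightarrow> 'g \<Rightarrow> 'g \<Rightarrow> 'a" where
  "wedge11 \<alpha> \<beta> = (\<lambda>X Y. \<alpha> X * \<beta> Y - \<alpha> Y * \<beta> X)"

definition in_span2 :: "(nat \<Rightarrow> 'g \<Rightarrow> real) \<Rightarrow> (nat \<times> nat) set \<Rightarrow> ('g \<Rightarrow> 'g \<Rightarrow> real) \<Rightarrow> bool" where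
  "in_span2 e S \<beta> \<longleftrightarrow> (\<exists>c. \<beta> = (\<lambda>X Y. \<Sum>p\<in>S. c p * wedge11 (e (fst p)) (e (snd p)) X Y))"

definition dual_basis6 :: "(nat \<Rightarrow> 'g::real_vector \<Rightarrow> real) \<Rightarrow> bool" where
  "dual_basis6 e \<longleftrightarrow> (\<forall>i\<in>{1..6}. linear (e i)) \<and>
     (\<forall>c. (\<forall>X. (\<Sum>i=1..6. c i * e i X) = 0) \<longrightarrow> (\<forall>i\<in>{1..6}. c i = 0)) \<and>
     (\<forall>f. linear f \<longrightarrow> (\<exists>c. \<forall>X. f X = (\<Sum>i=1..6. c i * e i X)))"

text \<open>Complex 1-forms on g (= complex-linear forms on g_C, determined by their real-linear
  restriction to g).\<close>
definition cform1 :: "('g::real_vector \<Rightarrow> complex) \<Rightarrow> bool" where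
  "cform1 \<omega> \<longleftrightarrow> linear \<omega>"

definition Lambda10 :: "('g::real_vector \<Rightarrow> 'g) \<Rightarrow> ('g \<Rightarrow> complex) set" where
  "Lambda10 J = {\<omega>. linear \<omega> \<and> (\<forall>X. \<omega> (J X) = \<i> * \<omega> X)}"

definition Lambda10_basis :: "('g::real_vector \<Rightarrow> 'g) \<Rightarrow> ('g \<Rightarrow> complex) \<Rightarrow> ('g \<Rightarrow> complex)
    \<Rightarrow> ('g \<Rightarrow> complex) \<Rightarrow> bool" where
  "Lambda10_basis J w1 w2 w3 \<longleftrightarrow> w1 \<in> Lambda10 J \<and> w2 \<in> Lambda10 J \<and> w3 \<in> Lambda10 J \<and>
     (\<forall>a b c. (\<forall>X. a * w1 X + b * w2 X + c * w3 X = 0) \<longrightarrow> a = 0 \<and> b = 0 \<and> c = 0) \<and>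
     (\<forall>\<omega>\<in>Lambda10 J. \<exists>a b c. \<forall>X. \<omega> X = a * w1 X + b * w2 X + c * w3 X)"

definition cpair :: "(nat \<Rightarrow> 'g \<Rightarrow> real) \<Rightarrow> nat \<Rightarrow> nat \<Rightarrow> 'g \<Rightarrow> complex" where
  "cpair e a b = (\<lambda>X. complex_of_real (e a X) + \<i> * complex_of_real (e b X))"

text \<open>The structure conditions: omega^i basis of Lambda^{1,0}, d omega^1 = 0,
  d omega^2 \<in> I(omega^1), d omega^3 \<in> I(omega^1, omega^2) (degree-2 parts of the ideals).\<close>
definition good_coframe :: "('g::real_vector \<Rightarrow> 'g \<Rightarrow> 'g) \<Rightarrow> ('g \<Rightarrow> 'g) \<Rightarrow> ('g \<Rightarrow> complex)
    \<Rightarrow> ('g \<Rightarrow> complex) \<Rightarrow> ('g \<Rightarrow> complex) \<Rightarrow> bool" where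
  "good_coframe br J w1 w2 w3 \<longleftrightarrow> Lambda10_basis J w1 w2 w3 \<and>
     d1 br w1 = (\<lambda>X Y. 0) \<and>
     (\<exists>\<beta>. cform1 \<beta> \<and> d1 br w2 = wedge11 w1 \<beta>) \<and>
     (\<exists>\<beta>1 \<beta>2. cform1 \<beta>1 \<and> cform1 \<beta>2 \<and>
        d1 br w3 = (\<lambda>X Y. wedge11 w1 \<beta>1 X Y + wedge11 w2 \<beta>2 X Y))"

end

theory Submission
  imports Defs
begin

text \<open>
  Write \<open>W\<^sub>1\<close> for the common kernel of \<open>e\<^sup>1, e\<^sup>2\<close> and \<open>W\<^sub>2\<close> for that of \<open>\<omega>\<^sup>1, \<omega>\<^sup>2\<close>.
  A nonzero \<open>J\<close>-stable subalgebra \<open>h\<close> satisfies \<open>[h,h] + J[h,h] \<noteq> h\<close>: otherwise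
  \<open>h = h\<^sup>k + Jh\<^sup>k\<close> gives \<open>[h,h] \<subseteq> h\<^sup>k\<^sup>+\<^sup>1 + Jh\<^sup>k\<^sup>+\<^sup>1\<close> by integrability, and so \<open>h\<close> vanishes by nilpotency.
  Hence there is a \<open>J\<close>-stable ideal \<open>W\<^sub>1 \<supseteq> [g,g]\<close> of dimension 4.

  If \<open>W\<^sub>1\<close> is not abelian, a \<open>J\<close>-stable plane \<open>W\<^sub>2\<close> with \<open>[W\<^sub>1,W\<^sub>1] \<subseteq> W\<^sub>2 \<subseteq> W\<^sub>1\<close> turns out to be the centre of
  \<open>W\<^sub>1\<close>, hence an ideal of \<open>g\<close>. If \<open>W\<^sub>1\<close> is abelian, take a flag
  \<open>W\<^sub>1 \<supset> F\<^sub>3 \<supset> F\<^sub>4 \<supset> F\<^sub>5 = \<langle>z\<rangle>\<close> with \<open>[g,F\<^sub>i] \<subseteq> F\<^sub>i\<^sub>+\<^sub>1\<close>. Since \<open>z\<close> is central, \<open>[JX,Jz] = J[X,Jz]\<close>; so if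
  \<open>Jz \<in> F\<^sub>3\<close>, then \<open>\<langle>z,Jz\<rangle>\<close> or \<open>F\<^sub>4\<close> is a \<open>J\<close>-stable ideal. A \<open>J\<close>-stable plane \<open>W\<^sub>2\<close> that is an ideal and commutes
  with \<open>W\<^sub>1\<close> yields case (I). Otherwise \<open>Jz \<notin> F\<^sub>3\<close>, and some \<open>v \<in> F\<^sub>4 - F\<^sub>5\<close> has \<open>Jv \<in> F\<^sub>3 - F\<^sub>4\<close>; then the
  basis \<open>- Jz, - Jv, v, z\<close> of \<open>W\<^sub>1\<close> yields case (II).
\<close>

section \<open>Subspaces and six-vector frames\<close>

lemma subspace_codim_one_between:
  fixes S T :: "'g::euclidean_space set"
  assumes S: "subspace S" and T: "subspace T" and ST: "S \<subset> T"
  obtains V where "subspace V" "S \<subseteq> V" "V \<subseteq> T" "dim T = Suc (dim V)"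
proof -
  obtain B where B: "B \<subseteq> S" "independent B" "S \<subseteq> span B"
    using basis_exists[of S] by metis
  have "B \<subseteq> T" using B ST by blast
  then obtain C where C: "B \<subseteq> C" "C \<subseteq> T" "independent C" "T \<subseteq> span C"
    using maximal_independent_subset_extend[of B T] B(2) by blast
  have spB: "span B = S" using B S by (simp add: span_minimal subset_antisym)
  have spC: "span C = T" using C T by (simp add: span_minimal subset_antisym)
  obtain c where c: "c \<in> C" "c \<notin> B" using span_mono[of C B] spB spC ST by blast
  have fC: "finite C" using C(3) independent_imp_finite by blast
  show thesis
  proof
    show "subspace (span (C - {c}))" by simp
    show "S \<subseteq> span (C - {c})" unfolding spB[symmetric] using C c by (intro span_mono) auto
    show "span (C - {c}) \<subseteq> T" unfolding spC[symmetric] by (intro span_mono) auto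
    have "dim T = card C" using spC C(3) dim_span_eq_card_independent by metis
    moreover have "dim (span (C - {c})) = card (C - {c})"
      using C(3) by (intro dim_span_eq_card_independent) (rule independent_mono[of C], auto)
    moreover have "card C = Suc (card (C - {c}))"
      using fC c by (metis card.remove)
    ultimately show "dim T = Suc (dim (span (C - {c})))" by simp
  qed
qed

text \<open>One equivalence makes the \<open>v\<close>'s a basis and the \<open>f\<close>'s its
  coordinate functions: left to right it gives uniqueness of coefficients, right to left it gives
  spanning.\<close>

definition dual_frame :: "('g::real_vector \<Rightarrow> real) \<Rightarrow> ('g \<Rightarrow> real) \<Rightarrow> ('g \<Rightarrow> real) \<Rightarrow> ('g \<Rightarrow> real) \<Rightarrow>
    ('g \<Rightarrow> real) \<Rightarrow> ('g \<Rightarrow> real) \<Rightarrow> 'g \<Rightarrow> 'g \<Rightarrow> 'g \<Rightarrow> 'g \<Rightarrow> 'g \<Rightarrow> 'g \<Rightarrow> bool" where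
  "dual_frame f1 f2 f3 f4 f5 f6 v1 v2 v3 v4 v5 v6 \<longleftrightarrow>
    (\<forall>X k1 k2 k3 k4 k5 k6.
      X = k1 *\<^sub>R v1 + k2 *\<^sub>R v2 + k3 *\<^sub>R v3 + k4 *\<^sub>R v4 + k5 *\<^sub>R v5 + k6 *\<^sub>R v6 \<longleftrightarrow>
      f1 X = k1 \<and> f2 X = k2 \<and> f3 X = k3 \<and> f4 X = k4 \<and> f5 X = k5 \<and> f6 X = k6)"

lemma dual_frame_expand:
  assumes "dual_frame f1 f2 f3 f4 f5 f6 v1 v2 v3 v4 v5 v6"
  shows "X = f1 X *\<^sub>R v1 + f2 X *\<^sub>R v2 + f3 X *\<^sub>R v3 + f4 X *\<^sub>R v4 + f5 X *\<^sub>R v5 + f6 X *\<^sub>R v6"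
  using assms unfolding dual_frame_def by blast

lemma dual_frame_coords:
  assumes "dual_frame f1 f2 f3 f4 f5 f6 v1 v2 v3 v4 v5 v6"
    and "X = k1 *\<^sub>R v1 + k2 *\<^sub>R v2 + k3 *\<^sub>R v3 + k4 *\<^sub>R v4 + k5 *\<^sub>R v5 + k6 *\<^sub>R v6"
  shows "f1 X = k1" "f2 X = k2" "f3 X = k3" "f4 X = k4" "f5 X = k5" "f6 X = k6"
  using assms unfolding dual_frame_def by blast+

lemma dual_frame_linear:
  assumes "dual_frame f1 f2 f3 f4 f5 f6 v1 v2 v3 v4 v5 v6"
  shows "linear f1" "linear f2" "linear f3" "linear f4" "linear f5" "linear f6"
proof -
  note ex = dual_frame_expand[OF assms]
  have add: "X + Y = (f1 X + f1 Y) *\<^sub>R v1 + (f2 X + f2 Y) *\<^sub>R v2 + (f3 X + f3 Y) *\<^sub>R v3 +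
      (f4 X + f4 Y) *\<^sub>R v4 + (f5 X + f5 Y) *\<^sub>R v5 + (f6 X + f6 Y) *\<^sub>R v6" for X Y
    using arg_cong2[where f = "(+)", OF ex[of X] ex[of Y]] by (simp add: algebra_simps)
  have scale: "k *\<^sub>R X = (k * f1 X) *\<^sub>R v1 + (k * f2 X) *\<^sub>R v2 + (k * f3 X) *\<^sub>R v3 +
      (k * f4 X) *\<^sub>R v4 + (k * f5 X) *\<^sub>R v5 + (k * f6 X) *\<^sub>R v6" for X k
    using arg_cong[where f = "(*\<^sub>R) k", OF ex[of X]] by (simp add: algebra_simps)
  show "linear f1" "linear f2" "linear f3" "linear f4" "linear f5" "linear f6"
    by (rule linearI; simp add: dual_frame_coords[OF assms add] dual_frame_coords[OF assms scale])+
qed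

text \<open>Case (II) pairs \<open>e 4\<close> with \<open>e 5\<close> and \<open>e 3\<close> with
  \<open>e 6\<close>; this order puts the partners side by side, as \<open>good_coframeI\<close>
  expects.\<close>

lemma dual_frame_permute:
  assumes "dual_frame f1 f2 f3 f4 f5 f6 v1 v2 v3 v4 v5 v6"
  shows "dual_frame f1 f2 f4 f5 f3 f6 v1 v2 v4 v5 v3 v6"
proof -
  have permuted: "k1 *\<^sub>R v1 + k2 *\<^sub>R v2 + k3 *\<^sub>R v4 + k4 *\<^sub>R v5 + k5 *\<^sub>R v3 + k6 *\<^sub>R v6 =
    k1 *\<^sub>R v1 + k2 *\<^sub>R v2 + k5 *\<^sub>R v3 + k3 *\<^sub>R v4 + k4 *\<^sub>R v5 + k6 *\<^sub>R v6" for k1 k2 k3 k4 k5 k6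
    by simp
  show ?thesis unfolding dual_frame_def permuted using assms unfolding dual_frame_def by blast
qed

lemma dual_frame_values:
  assumes "dual_frame f1 f2 f3 f4 f5 f6 v1 v2 v3 v4 v5 v6"
  shows "f1 v1 = 1" "f2 v1 = 0" "f3 v1 = 0" "f4 v1 = 0" "f5 v1 = 0" "f6 v1 = 0"
    "f1 v2 = 0" "f2 v2 = 1" "f3 v2 = 0" "f4 v2 = 0" "f5 v2 = 0" "f6 v2 = 0"
    "f1 v3 = 0" "f2 v3 = 0" "f3 v3 = 1" "f4 v3 = 0" "f5 v3 = 0" "f6 v3 = 0"
    "f1 v4 = 0" "f2 v4 = 0" "f3 v4 = 0" "f4 v4 = 1" "f5 v4 = 0" "f6 v4 = 0"
    "f1 v5 = 0" "f2 v5 = 0" "f3 v5 = 0" "f4 v5 = 0" "f5 v5 = 1" "f6 v5 = 0"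
    "f1 v6 = 0" "f2 v6 = 0" "f3 v6 = 0" "f4 v6 = 0" "f5 v6 = 0" "f6 v6 = 1"
  using dual_frame_coords[OF assms, of v1 1 0 0 0 0 0] dual_frame_coords[OF assms, of v2 0 1 0 0 0 0]
    dual_frame_coords[OF assms, of v3 0 0 1 0 0 0] dual_frame_coords[OF assms, of v4 0 0 0 1 0 0]
    dual_frame_coords[OF assms, of v5 0 0 0 0 1 0] dual_frame_coords[OF assms, of v6 0 0 0 0 0 1]
  by simp_all

lemma dual_frame_exists:
  fixes v1 :: "'g::euclidean_space"
  assumes "DIM('g) = 6" "v6 \<noteq> 0" "v5 \<notin> span {v6}" "v4 \<notin> span {v5, v6}"
    "v3 \<notin> span {v4, v5, v6}" "v2 \<notin> span {v3, v4, v5, v6}" "v1 \<notin> span {v2, v3, v4, v5, v6}"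
  obtains e :: "nat \<Rightarrow> 'g \<Rightarrow> real"
  where "dual_frame (e 1) (e 2) (e 3) (e 4) (e 5) (e 6) v1 v2 v3 v4 v5 v6"
proof -
  define B where "B = {v1, v2, v3, v4, v5, v6}"
  have ind: "independent B"
    unfolding B_def using assms(2-) by (intro independent_insertI independent_empty) auto
  have nsp: "v \<notin> A" if "v \<notin> span A" for v :: 'g and A
    using that span_base by blast
  have ne: "v1 \<notin> {v2, v3, v4, v5, v6}" "v2 \<notin> {v3, v4, v5, v6}" "v3 \<notin> {v4, v5, v6}"
    "v4 \<notin> {v5, v6}" "v5 \<notin> {v6}"
    using nsp[OF assms(7)] nsp[OF assms(6)] nsp[OF assms(5)] nsp[OF assms(4)] nsp[OF assms(3)]
    by simp_all
  then have card: "card B = 6" unfolding B_def by simp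
  have sp: "span B = UNIV"
    using dim_eq_full[of B] dim_span_eq_card_independent[OF ind] card assms(1) by simp
  \<comment> \<open>Forms are numbered from 1 and list positions from 0, hence
    \<open>i - 1\<close>.\<close>
  define e where "e i X = representation B X ([v1, v2, v3, v4, v5, v6] ! (i - 1))" for i X
  have e1: "e 1 X = representation B X v1" "e 2 X = representation B X v2" "e 3 X = representation B X v3"
    "e 4 X = representation B X v4" "e 5 X = representation B X v5" "e 6 X = representation B X v6" for X
    by (simp_all add: e_def)
  have exp: "e 1 X *\<^sub>R v1 + e 2 X *\<^sub>R v2 + e 3 X *\<^sub>R v3 + e 4 X *\<^sub>R v4 + e 5 X *\<^sub>R v5 + e 6 X *\<^sub>R v6 = X" for X
  proof -
    have "X = (\<Sum>b\<in>B. representation B X b *\<^sub>R b)"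
      using sum_representation_eq[OF ind, of X B] sp by (simp add: B_def)
    also have "\<dots> = e 1 X *\<^sub>R v1 + e 2 X *\<^sub>R v2 + e 3 X *\<^sub>R v3 + e 4 X *\<^sub>R v4 + e 5 X *\<^sub>R v5 + e 6 X *\<^sub>R v6"
      unfolding e1 using ne by (simp add: B_def add.assoc)
    finally show ?thesis by simp
  qed
  have inB: "v1 \<in> B" "v2 \<in> B" "v3 \<in> B" "v4 \<in> B" "v5 \<in> B" "v6 \<in> B"
    unfolding B_def by simp_all
  have "e 1 X = k1 \<and> e 2 X = k2 \<and> e 3 X = k3 \<and> e 4 X = k4 \<and> e 5 X = k5 \<and> e 6 X = k6"
    if "X = k1 *\<^sub>R v1 + k2 *\<^sub>R v2 + k3 *\<^sub>R v3 + k4 *\<^sub>R v4 + k5 *\<^sub>R v5 + k6 *\<^sub>R v6"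
    for X k1 k2 k3 k4 k5 k6
    unfolding e1 that using ne
    by (auto simp: representation_add representation_scale ind sp inB representation_basis)
  then have "dual_frame (e 1) (e 2) (e 3) (e 4) (e 5) (e 6) v1 v2 v3 v4 v5 v6"
    unfolding dual_frame_def using exp by metis
  then show thesis by (rule that)
qed

lemma dual_frame_dual_basis6:
  assumes frame: "dual_frame (e 1) (e 2) (e 3) (e 4) (e 5) (e 6) v1 v2 v3 v4 v5 v6"
  shows "dual_basis6 e"
proof -
  have I: "{1..6::nat} = {1, 2, 3, 4, 5, 6}" by auto
  note vals = dual_frame_values[OF frame]
  have "\<forall>i\<in>{1..6}. c i = 0" if "\<And>X. (\<Sum>i=1..6. c i * e i X) = 0" for c
    using that[of v1] that[of v2] that[of v3] that[of v4] that[of v5] that[of v6]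
    unfolding I by (simp add: vals del: One_nat_def)
  moreover have "\<exists>c. \<forall>X. f X = (\<Sum>i=1..6. c i * e i X)" if f: "linear f" for f
  proof (intro exI allI)
    fix X
    show "f X = (\<Sum>i=1..6. f ([v1, v2, v3, v4, v5, v6] ! (i - 1)) * e i X)"
      using arg_cong[where f = f, OF dual_frame_expand[OF frame, of X]] unfolding I
      by (simp add: linear_add[OF f] linear_scale[OF f] algebra_simps del: One_nat_def)
  qed
  ultimately show ?thesis
    unfolding dual_basis6_def using dual_frame_linear[OF frame] unfolding I
    by (simp del: One_nat_def)
qed

text \<open>Computes the members of a flag as explicit spans, one vector at a time from the bottom
  line upwards.\<close>

lemma span_insert_eq:
  fixes F :: "'g::euclidean_space set"
  assumes "subspace F" "span B \<subseteq> F" "v \<in> F" "v \<notin> span B" "dim F = Suc (dim (span B))"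
  shows "span (insert v B) = F"
proof (rule subspace_dim_equal)
  have "insert v B \<subseteq> F" using assms span_superset[of B] by auto
  then show "span (insert v B) \<subseteq> F" using assms(1) by (rule span_minimal)
  show "dim F \<le> dim (span (insert v B))" using assms(4,5) by (simp add: dim_insert)
qed (use assms in auto)

lemma uminus_mem_iff: "subspace S \<Longrightarrow> - x \<in> S \<longleftrightarrow> x \<in> S"
  using subspace_neg[of S x] subspace_neg[of S "- x"] by auto

section \<open>Bracket calculus and nilpotency\<close>

locale nilpotent_complex_lie =
  fixes br :: "'g::euclidean_space \<Rightarrow> 'g \<Rightarrow> 'g" and J :: "'g \<Rightarrow> 'g"
  assumes lie: "lie_algebra br"
    and nil: "nilpotent_lie br"
    and complex_str: "complex_structure br J"
begin

lemma bilinear_br: "bilinear br"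
  using lie unfolding lie_algebra_def by blast

lemma br_antisym: "br x y = - br y x"
  using lie unfolding lie_algebra_def by blast

lemma jacobi: "br x (br y z) + br y (br z x) + br z (br x y) = 0"
  using lie unfolding lie_algebra_def by blast

lemmas br_simps = bilinear_ladd[OF bilinear_br] bilinear_radd[OF bilinear_br]
  bilinear_lmul[OF bilinear_br] bilinear_rmul[OF bilinear_br]
  bilinear_lneg[OF bilinear_br] bilinear_rneg[OF bilinear_br]
  bilinear_lzero[OF bilinear_br] bilinear_rzero[OF bilinear_br]
  bilinear_lsub[OF bilinear_br] bilinear_rsub[OF bilinear_br]

lemma br_self: "br x x = 0"
  using br_antisym[of x x] by (simp add: eq_neg_iff_add_eq_0 flip: scaleR_2)

lemma linear_J: "linear J" and J_J [simp]: "J (J x) = - x"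
  and integrability: "br (J x) (J y) = br x y + J (br (J x) y) + J (br x (J y))"
  using complex_str unfolding complex_structure_def by blast+

lemmas J_simps = linear_add[OF linear_J] linear_scale[OF linear_J] linear_neg[OF linear_J]
  linear_diff[OF linear_J] linear_0[OF linear_J]

lemma br_span:
  assumes "\<And>x y. x \<in> A \<Longrightarrow> y \<in> B \<Longrightarrow> br x y \<in> K" "subspace K" "x \<in> span A" "y \<in> span B"
  shows "br x y \<in> K"
proof -
  have 1: "br x y \<in> K" if "x \<in> A" for x
    using assms(4)
  proof (induction rule: span_induct)
    case base then show ?case
      using assms(2) by (auto simp: subspace_def br_simps)
  next
    case (step y) then show ?case using assms(1) that by blast
  qed
  show ?thesis
    using assms(3)
  proof (induction rule: span_induct)
    case base then show ?case
      using assms(2) by (auto simp: subspace_def br_simps)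
  next
    case (step x) then show ?case using 1 by blast
  qed
qed

text \<open>A Nakayama-type argument: feeding the inclusion for \<open>V\<close> into itself pushes
  \<open>V\<close> into the span of \<open>lower_central br k\<close> and \<open>U\<close> for every
  \<open>k\<close>, since the \<open>h\<close>-stable \<open>U\<close> absorbs its own brackets.
  Nilpotency then leaves only \<open>U\<close>.\<close>

lemma nilpotent_action:
  assumes U: "\<And>x y. x \<in> h \<Longrightarrow> y \<in> U \<Longrightarrow> br x y \<in> U" "subspace U"
    and V: "V \<subseteq> span ({br x y | x y. x \<in> h \<and> y \<in> V} \<union> U)"
  shows "V \<subseteq> U"
proof -
  have "V \<subseteq> span (lower_central br k \<union> U)" for k
  proof (induction k)
    case 0 show ?case by (simp add: span_superset)
  next
    case (Suc k)
    let ?K = "span (lower_central br (Suc k) \<union> U)"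
    have "br x y \<in> ?K" if "x \<in> h" "y \<in> V" for x y
    proof (rule br_span)
      show "subspace ?K" by simp
      show "x \<in> span {x}" by (simp add: span_base)
      show "y \<in> span (lower_central br k \<union> U)" using Suc that by blast
      show "br x' y' \<in> ?K" if "x' \<in> {x}" "y' \<in> lower_central br k \<union> U" for x' y'
      proof (cases "y' \<in> U")
        case True
        then have "br x' y' \<in> U" using U \<open>x \<in> h\<close> that by blast
        then show ?thesis by (simp add: span_base)
      next
        case False
        then have "br x' y' \<in> lower_central br (Suc k)" using that by (auto intro: span_base)
        then show ?thesis by (meson UnI1 span_base)
      qed
    qed
    then have "{br x y | x y. x \<in> h \<and> y \<in> V} \<union> U \<subseteq> ?K"
      using span_superset by blast
    then have "span ({br x y | x y. x \<in> h \<and> y \<in> V} \<union> U) \<subseteq> ?K"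
      by (rule span_minimal) simp
    then show ?case using V by blast
  qed
  moreover obtain k where "lower_central br k = {0}" using nil unfolding nilpotent_lie_def by blast
  ultimately have "V \<subseteq> span ({0} \<union> U)" by metis
  also have "\<dots> = U" using U(2) by (simp add: subspace_0 insert_absorb)
  finally show ?thesis .
qed

text \<open>By \<open>nilpotent_action\<close> the span of \<open>[h, V]\<close> and
  \<open>U\<close> is proper in \<open>V\<close>, so any hyperplane of \<open>V\<close> containing
  it will do. Iterated with \<open>h = UNIV\<close> this yields flags of ideals.\<close>

lemma stable_hyperplane:
  assumes U: "\<And>x y. x \<in> h \<Longrightarrow> y \<in> U \<Longrightarrow> br x y \<in> U" "subspace U"
    and V: "\<And>x y. x \<in> h \<Longrightarrow> y \<in> V \<Longrightarrow> br x y \<in> V" "subspace V" and UV: "U \<subset> V"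
  obtains V' where "subspace V'" "U \<subseteq> V'" "V' \<subseteq> V" "dim V = Suc (dim V')"
    "\<And>x y. x \<in> h \<Longrightarrow> y \<in> V \<Longrightarrow> br x y \<in> V'"
proof -
  let ?S = "span ({br x y | x y. x \<in> h \<and> y \<in> V} \<union> U)"
  have "?S \<subseteq> V" using V UV by (intro span_minimal) auto
  moreover have "?S \<noteq> V" using nilpotent_action[of h U V] U UV by blast
  ultimately obtain V' where V': "subspace V'" "?S \<subseteq> V'" "V' \<subseteq> V" "dim V = Suc (dim V')"
    using subspace_codim_one_between[of ?S V] V(2) by blast
  have "{br x y | x y. x \<in> h \<and> y \<in> V} \<union> U \<subseteq> V'" 
    using subset_trans[OF span_superset V'(2)] .
  then show thesis using that[of V'] V' by blast
qed

section \<open>\<open>J\<close>-stable subspaces\<close>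

lemma J_notin_span:
  assumes "subspace S" "\<And>x. x \<in> S \<Longrightarrow> J x \<in> S" "v \<notin> S"
  shows "J v \<notin> span (insert v S)"
proof
  assume "J v \<in> span (insert v S)"
  then obtain k where k: "J v - k *\<^sub>R v \<in> S"
    using assms(1) by (auto simp: span_breakdown_eq span_eq_iff[THEN iffD2])
  \<comment> \<open>\<open>(J + k) (J - k) = - (1 + k * k)\<close> is invertible, so
    \<open>J\<close> has no real eigenvalue modulo \<open>S\<close>.\<close>
  have "J (J v - k *\<^sub>R v) + k *\<^sub>R (J v - k *\<^sub>R v) \<in> S"
    using k assms by (auto intro: subspace_add subspace_scale)
  moreover have "J (J v - k *\<^sub>R v) + k *\<^sub>R (J v - k *\<^sub>R v) = (- (1 + k * k)) *\<^sub>R v"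
    by (simp add: J_simps algebra_simps)
  ultimately have m: "(- (1 + k * k)) *\<^sub>R v \<in> S" by simp
  have "1 + k * k \<noteq> 0" using zero_le_square[of k] by linarith
  then have "v \<in> S" using subspace_scale[OF assms(1) m, of "inverse (- (1 + k * k))"] by simp
  then show False using assms by blast
qed

text \<open>\<open>J_notin_span\<close> supplies the second new dimension. The case
  \<open>S = {0}\<close> later shows that a plane spanned by \<open>v\<close> and \<open>J v\<close>
  is \<open>J\<close>-stable.\<close>

lemma J_stable_add:
  assumes "subspace S" "\<And>x. x \<in> S \<Longrightarrow> J x \<in> S" "v \<notin> S"
  shows "dim (span ({v, J v} \<union> S)) = dim S + 2"
    and "x \<in> span ({v, J v} \<union> S) \<Longrightarrow> J x \<in> span ({v, J v} \<union> S)"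
proof -
  have "J v \<notin> span (insert v S)" "v \<notin> span S"
    using J_notin_span[OF assms] assms by (simp_all add: span_eq_iff[THEN iffD2])
  then show "dim (span ({v, J v} \<union> S)) = dim S + 2"
    using dim_insert[of "J v" "insert v S"] dim_insert[of v S] by (simp add: insert_commute)
  show "J x \<in> span ({v, J v} \<union> S)" if "x \<in> span ({v, J v} \<union> S)"
    using that
  proof (induction rule: span_induct)
    case base then show ?case
      by (auto simp: subspace_def J_simps intro: span_add span_scale span_zero)
  next
    case (step x)
    then consider "x = v" | "x = J v" | "x \<in> S" by blast
    then show ?case
    proof cases
      case 2
      have "v \<in> span ({v, J v} \<union> S)" by (simp add: span_base)
      then show ?thesis using span_neg 2 by simp
    qed (use assms(2) in \<open>auto intro: span_base\<close>)
  qed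
qed

text \<open>Pairs \<open>v, J v\<close> are added to \<open>S\<close> until one more pair would fill
  \<open>T\<close>.\<close>

lemma J_stable_codim_two_between:
  assumes "subspace S" "\<And>x. x \<in> S \<Longrightarrow> J x \<in> S" "subspace T" "\<And>x. x \<in> T \<Longrightarrow> J x \<in> T" "S \<subset> T"
  shows "\<exists>V. subspace V \<and> (\<forall>x\<in>V. J x \<in> V) \<and> S \<subseteq> V \<and> V \<subseteq> T \<and> dim T = dim V + 2"
  using assms
proof (induction "dim T - dim S" arbitrary: S rule: less_induct)
  case less
  obtain v where v: "v \<in> T" "v \<notin> S" using less.prems by blast
  let ?S = "span ({v, J v} \<union> S)"
  note S = J_stable_add[OF less.prems(1,2) v(2)]
  have sub: "?S \<subseteq> T" using v less.prems by (intro span_minimal) auto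
  have "S \<subseteq> ?S" using span_superset by blast
  show ?case
  proof (cases "?S = T")
    case True
    then show ?thesis using S(1) less.prems by (intro exI[of _ S]) auto
  next
    case False
    have "dim ?S \<le> dim T" using sub by (rule dim_subset)
    then have "dim T - dim ?S < dim T - dim S" using S(1) by linarith
    from less.hyps[OF this] S(2) less.prems(3,4) sub False
    obtain V where "subspace V \<and> (\<forall>x\<in>V. J x \<in> V) \<and> ?S \<subseteq> V \<and> V \<subseteq> T \<and> dim T = dim V + 2"
      by (metis psubsetI subspace_span)
    then show ?thesis using \<open>S \<subseteq> ?S\<close> by blast
  qed
qed

lemma J_span_stable: "x \<in> span (P \<union> J ` P) \<Longrightarrow> J x \<in> span (P \<union> J ` P)"
proof (induction rule: span_induct)
  case base then show ?case
    by (auto simp: subspace_def J_simps intro: span_add span_scale span_zero)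
next
  case (step x) then show ?case
    by (metis J_J UnCI UnE imageE image_eqI span_base span_neg)
qed

text \<open>Hypothesis \<open>gen\<close> expresses \<open>h = [h,h] + J[h,h]\<close> through the
  \<open>J\<close>-stable subspaces containing all brackets; the proof carries this generation
  property down the lower central series.\<close>

lemma J_stable_subalgebra_trivial:
  assumes h: "subspace h" "\<And>x. x \<in> h \<Longrightarrow> J x \<in> h" "\<And>x y. x \<in> h \<Longrightarrow> y \<in> h \<Longrightarrow> br x y \<in> h"
    and gen: "\<And>K. subspace K \<Longrightarrow> (\<And>x. x \<in> K \<Longrightarrow> J x \<in> K) \<Longrightarrow>
      (\<And>x y. x \<in> h \<Longrightarrow> y \<in> h \<Longrightarrow> br x y \<in> K) \<Longrightarrow> h \<subseteq> K"
  shows "h \<subseteq> {0}"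
proof -
  \<comment> \<open>\<open>P\<close> stands in for the \<open>k\<close>-th lower central term of
    \<open>h\<close>. It is merely a set; only its span together with its image under
    \<open>J\<close> is a \<open>J\<close>-stable subspace.\<close>
  have "\<exists>P. P \<subseteq> lower_central br k \<and> P \<subseteq> h \<and> (\<forall>x\<in>h. \<forall>y\<in>P. br x y \<in> P) \<and> h \<subseteq> span (P \<union> J ` P)" for k
  proof (induction k)
    case 0
    show ?case using h by (intro exI[of _ h]) (auto intro: span_base)
  next
    case (Suc k)
    then obtain P where P: "P \<subseteq> lower_central br k" "P \<subseteq> h" "\<And>x y. x \<in> h \<Longrightarrow> y \<in> P \<Longrightarrow> br x y \<in> P"
      "h \<subseteq> span (P \<union> J ` P)" by blast
    define Q where "Q = {br x y | x y. x \<in> h \<and> y \<in> P}"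
    have Qi: "br x y \<in> Q" if "x \<in> h" "y \<in> P" for x y using that unfolding Q_def by blast
    have QP: "Q \<subseteq> P" using P(3) unfolding Q_def by blast
    let ?K = "span (Q \<union> J ` Q)"
    have Q1: "br x y \<in> ?K" "J (br x y) \<in> ?K" if "x \<in> h" "y \<in> P" for x y
      using Qi[OF that] by (auto intro: span_base)
    have Q2: "br y x \<in> ?K" "J (br y x) \<in> ?K" if "x \<in> h" "y \<in> P" for x y
      using Q1[OF that] br_antisym[of y x] by (auto simp: J_simps intro: span_neg)
    have "h \<subseteq> ?K"
    proof (rule gen)
      show "br x y \<in> ?K" if "x \<in> h" "y \<in> h" for x y
      proof (rule br_span[where A = "P \<union> J ` P" and B = "P \<union> J ` P"])
        show "br x y \<in> ?K" if xy: "x \<in> P \<union> J ` P" "y \<in> P \<union> J ` P" for x y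
        proof -
          have "x \<in> h" "y \<in> h" using xy P(2) h(2) by auto
          \<comment> \<open>One entry in \<open>P\<close> suffices, by antisymmetry. If both entries
            are images under \<open>J\<close> of elements of \<open>P\<close>, integrability
            rewrites the bracket into terms with an entry in \<open>P\<close>.\<close>
          consider "y \<in> P" | "x \<in> P" | x' y' where "x' \<in> P" "y' \<in> P" "x = J x'" "y = J y'" using xy by blast
          then show ?thesis
          proof cases
            case 3
            then have "x' \<in> h" "y' \<in> h" using P(2) by auto
            then show ?thesis unfolding 3(3,4) integrability
              using 3 h(2) by (intro span_add Q1 Q2) auto
          qed (use \<open>x \<in> h\<close> \<open>y \<in> h\<close> Q1 Q2 in auto)
        qed
      qed (use that P(4) in auto)
    qed (use J_span_stable in auto)
    moreover have "Q \<subseteq> lower_central br (Suc k)"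
      using P(1) unfolding Q_def by (auto intro: span_base)
    ultimately show ?case using QP P(2) Qi by (intro exI[of _ Q]) auto
  qed
  moreover obtain k where "lower_central br k = {0}" using nil unfolding nilpotent_lie_def by blast
  ultimately obtain P where "P \<subseteq> {0}" "h \<subseteq> span (P \<union> J ` P)" by metis
  moreover have "P \<union> J ` P \<subseteq> {0}" using \<open>P \<subseteq> {0}\<close> by (auto simp: J_simps)
  ultimately show ?thesis using span_minimal[of "P \<union> J ` P" "{0}"] by auto
qed

text \<open>\<open>J_stable_subalgebra_trivial\<close> provides a \<open>J\<close>-stable
  \<open>K\<close> containing \<open>[h,h]\<close> but not \<open>h\<close>; then
  \<open>K \<inter> h\<close> is enlarged to codimension two in \<open>h\<close>. Taking
  \<open>h = UNIV\<close> gives \<open>W1\<close>, and \<open>h = W1\<close> gives the plane of the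
  nonabelian case.\<close>

lemma J_stable_derived:
  assumes h: "subspace h" "\<And>x. x \<in> h \<Longrightarrow> J x \<in> h" "\<And>x y. x \<in> h \<Longrightarrow> y \<in> h \<Longrightarrow> br x y \<in> h" "h \<noteq> {0}"
  obtains W where "subspace W" "\<And>x. x \<in> W \<Longrightarrow> J x \<in> W" "W \<subseteq> h" "dim h = dim W + 2"
    "\<And>x y. x \<in> h \<Longrightarrow> y \<in> h \<Longrightarrow> br x y \<in> W"
proof -
  have "\<not> h \<subseteq> {0}" using h(1,4) subspace_0 by blast
  then obtain K where K: "subspace K" "\<And>x. x \<in> K \<Longrightarrow> J x \<in> K"
      "\<And>x y. x \<in> h \<Longrightarrow> y \<in> h \<Longrightarrow> br x y \<in> K" "\<not> h \<subseteq> K"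
    using J_stable_subalgebra_trivial[OF h(1-3)] by metis
  have "subspace (K \<inter> h)" using K h by (simp add: subspace_inter)
  moreover have "J x \<in> K \<inter> h" if "x \<in> K \<inter> h" for x using that K(2) h(2) by blast
  moreover have "K \<inter> h \<subset> h" using K(4) by blast
  ultimately obtain W where W: "subspace W" "\<forall>x\<in>W. J x \<in> W" "K \<inter> h \<subseteq> W" "W \<subseteq> h" "dim h = dim W + 2"
    using J_stable_codim_two_between[of "K \<inter> h" h, OF _ _ h(1,2)] by auto
  show thesis
  proof
    show "br x y \<in> W" if "x \<in> h" "y \<in> h" for x y using K(3) h(3) W(3) that by blast
  qed (use W in auto)
qed

text \<open>The two integrability terms with entry \<open>z\<close> vanish, so the bracket with
  \<open>J z\<close> commutes with \<open>J\<close>.\<close>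

lemma br_J_central:
  assumes "\<And>x. br x z = 0"
  shows "br (J x) (J z) = J (br x (J z))"
  using integrability[of x z] assms by (simp add: J_simps)

section \<open>Structure equations in an adapted frame\<close>

lemma bracket_expansion:
  assumes "dual_frame f1 f2 f3 f4 f5 f6 v1 v2 v3 v4 v5 v6"
  shows "br X Y = wedge11 f1 f2 X Y *\<^sub>R br v1 v2 + wedge11 f1 f3 X Y *\<^sub>R br v1 v3
    + wedge11 f1 f4 X Y *\<^sub>R br v1 v4 + wedge11 f1 f5 X Y *\<^sub>R br v1 v5 + wedge11 f1 f6 X Y *\<^sub>R br v1 v6
    + wedge11 f2 f3 X Y *\<^sub>R br v2 v3 + wedge11 f2 f4 X Y *\<^sub>R br v2 v4 + wedge11 f2 f5 X Y *\<^sub>R br v2 v5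
    + wedge11 f2 f6 X Y *\<^sub>R br v2 v6 + wedge11 f3 f4 X Y *\<^sub>R br v3 v4 + wedge11 f3 f5 X Y *\<^sub>R br v3 v5
    + wedge11 f3 f6 X Y *\<^sub>R br v3 v6 + wedge11 f4 f5 X Y *\<^sub>R br v4 v5 + wedge11 f4 f6 X Y *\<^sub>R br v4 v6
    + wedge11 f5 f6 X Y *\<^sub>R br v5 v6"
  using arg_cong2[where f = br, OF dual_frame_expand[OF assms, of X] dual_frame_expand[OF assms, of Y]]
  by (simp add: br_simps br_self wedge11_def br_antisym[of v2 v1] br_antisym[of v3 v1]
      br_antisym[of v4 v1] br_antisym[of v5 v1] br_antisym[of v6 v1] br_antisym[of v3 v2]
      br_antisym[of v4 v2] br_antisym[of v5 v2] br_antisym[of v6 v2] br_antisym[of v4 v3]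
      br_antisym[of v5 v3] br_antisym[of v6 v3] br_antisym[of v5 v4] br_antisym[of v6 v4]
      br_antisym[of v6 v5] algebra_simps)

text \<open>
  Both cases of the theorem are instances: \<open>(b, c) = (v\<^sub>3, v\<^sub>5)\<close> in (I) and \<open>(b, c) = (v\<^sub>4, v\<^sub>3)\<close> in (II).
  Modulo \<open>\<omega>\<^sup>1\<close> and \<open>\<omega>\<^sup>2\<close> the form \<open>d\<omega>\<^sup>3\<close> is a multiple of \<open>f\<^sup>2 \<and> f\<^sup>4\<close>, and
  integrability makes the multiple zero; this is where \<open>\<beta>1\<close> and \<open>\<beta>2\<close> come from.
\<close>

lemma good_coframeI:
  assumes frame: "dual_frame f1 f2 f3 f4 f5 f6 a (J a) b (J b) c (J c)"
    and f12: "\<And>X Y. f1 (br X Y) = 0" "\<And>X Y. f2 (br X Y) = 0"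
    and f34: "\<And>X. f3 (br X b) = 0" "\<And>X. f3 (br X (J b)) = 0" "\<And>X. f4 (br X (J b)) = 0"
    and central: "\<And>X. br X (J c) = 0"
    and comm: "br b c = 0" "br (J b) c = 0"
  shows "good_coframe br J (\<lambda>X. complex_of_real (f1 X) + \<i> * complex_of_real (f2 X))
    (\<lambda>X. complex_of_real (f3 X) + \<i> * complex_of_real (f4 X))
    (\<lambda>X. complex_of_real (f5 X) + \<i> * complex_of_real (f6 X))"
proof -
  define w1 w2 w3 where w1: "w1 = (\<lambda>X. complex_of_real (f1 X) + \<i> * complex_of_real (f2 X))"
    and w2: "w2 = (\<lambda>X. complex_of_real (f3 X) + \<i> * complex_of_real (f4 X))"
    and w3: "w3 = (\<lambda>X. complex_of_real (f5 X) + \<i> * complex_of_real (f6 X))"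
  note vals = dual_frame_values[OF frame]
  note lin = dual_frame_linear[OF frame]
  note f_simps = lin[THEN linear_add] lin[THEN linear_scale]
  have ii: "\<i> * (\<i> * z) = - z" for z
    by (simp flip: mult.assoc)
  have "J X = (- f2 X) *\<^sub>R a + f1 X *\<^sub>R J a + (- f4 X) *\<^sub>R b + f3 X *\<^sub>R J b + (- f6 X) *\<^sub>R c + f5 X *\<^sub>R J c" for X
    using arg_cong[where f = J, OF dual_frame_expand[OF frame, of X]] by (simp add: J_simps)
  note fJ = dual_frame_coords[OF frame this]
  have wlin: "linear w1" "linear w2" "linear w3"
    unfolding w1 w2 w3 by (rule linearI; simp add: f_simps algebra_simps scaleR_conv_of_real)+
  have wJ: "w1 (J X) = \<i> * w1 X" "w2 (J X) = \<i> * w2 X" "w3 (J X) = \<i> * w3 X" for X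
    unfolding w1 w2 w3 by (simp_all add: fJ algebra_simps ii)
  have wv: "w1 a = 1" "w2 a = 0" "w3 a = 0" "w1 b = 0" "w2 b = 1" "w3 b = 0" "w1 c = 0" "w2 c = 0" "w3 c = 1"
    unfolding w1 w2 w3 by (simp_all add: vals)
  \<comment> \<open>\<open>J c\<close> is central and \<open>J (J c) = - c\<close>. Under
    \<open>w2\<close> and \<open>w3\<close> the coefficients of \<open>f1 \<and> f5\<close> and
    \<open>f2 \<and> f5\<close> thus differ by the factor \<open>\<i>\<close> and combine into a
    multiple of \<open>w1 \<and> f5\<close>.\<close>
  have Jac: "br (J a) c = J (br a c)"
    using br_J_central[of "J c" a] central by (simp add: br_simps J_simps)
  have "Lambda10_basis J w1 w2 w3"
    unfolding Lambda10_basis_def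
  proof (intro conjI allI impI ballI)
    show "w1 \<in> Lambda10 J" "w2 \<in> Lambda10 J" "w3 \<in> Lambda10 J"
      using wlin wJ by (simp_all add: Lambda10_def)
  next
    fix p q r assume "\<forall>X. p * w1 X + q * w2 X + r * w3 X = 0"
    from this[rule_format, of a] this[rule_format, of b] this[rule_format, of c]
    show "p = 0" "q = 0" "r = 0" by (simp_all add: wv)
  next
    fix w assume "w \<in> Lambda10 J"
    then have w: "linear w" "\<And>X. w (J X) = \<i> * w X" by (auto simp: Lambda10_def)
    show "\<exists>p q r. \<forall>X. w X = p * w1 X + q * w2 X + r * w3 X"
    proof (intro exI allI)
      fix X
      show "w X = w a * w1 X + w b * w2 X + w c * w3 X"
        using arg_cong[where f = w, OF dual_frame_expand[OF frame, of X]]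
        unfolding w1 w2 w3
        by (simp add: linear_add[OF w(1)] linear_scale[OF w(1)] w(2) scaleR_conv_of_real algebra_simps)
    qed
  qed
  moreover have "d1 br w1 = (\<lambda>X Y. 0)"
    unfolding d1_def w1 by (simp add: f12)
  moreover have "\<exists>\<beta>. cform1 \<beta> \<and> d1 br w2 = wedge11 w1 \<beta>"
  proof -
    have z: "w2 (br X (J b)) = 0" for X unfolding w2 by (simp add: f34)
    have i: "w2 (br (J a) (J b)) = w2 (br a b) + \<i> * w2 (br (J a) b) + \<i> * w2 (br a (J b))"
      unfolding integrability[of a b] by (simp add: linear_add[OF wlin(2)] wJ)
    \<comment> \<open>Integrability reduces to
      \<open>w2 (br a b) + \<i> * w2 (br (J a) b) = 0\<close>. Both values of \<open>w2\<close> are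
      purely imaginary, so comparing real and imaginary parts kills both.\<close>
    have "complex_of_real (f4 (br (J a) b)) = \<i> * complex_of_real (f4 (br a b))"
      using i unfolding z by (simp add: w2 f34 ii algebra_simps)
    then have "f4 (br (J a) b) = 0" "f4 (br a b) = 0"
      by (simp_all add: complex_eq_iff)
    then have z': "w2 (br (J a) b) = 0" "w2 (br a b) = 0"
      unfolding w2 by (simp_all add: f34)
    \<comment> \<open>Up to sign, what survives of the differential of \<open>w2\<close> is
      \<open>p\<close> on \<open>f1 \<and> f2\<close>, \<open>q\<close> on
      \<open>f1 \<and> f5\<close> and \<open>\<i> * q\<close> on
      \<open>f2 \<and> f5\<close>.\<close>
    define p q where "p = w2 (br a (J a))" and "q = w2 (br a c)"
    define \<beta> where "\<beta> = (\<lambda>X. - (p * complex_of_real (f2 X) + q * complex_of_real (f5 X)))"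
    have "cform1 \<beta>" unfolding cform1_def \<beta>_def
      by (rule linearI) (simp_all add: f_simps algebra_simps scaleR_conv_of_real)
    moreover have "d1 br w2 X Y = wedge11 w1 \<beta> X Y" for X Y
      unfolding d1_def
      by (subst bracket_expansion[OF frame])
        (simp add: linear_add[OF wlin(2)] linear_scale[OF wlin(2)] linear_0[OF wlin(2)] z z' comm central Jac wJ
         flip: p_def q_def, simp add: w1 \<beta>_def wedge11_def scaleR_conv_of_real algebra_simps)
    ultimately show ?thesis by blast
  qed
  moreover have "\<exists>\<beta>1 \<beta>2. cform1 \<beta>1 \<and> cform1 \<beta>2 \<and>
      d1 br w3 = (\<lambda>X Y. wedge11 w1 \<beta>1 X Y + wedge11 w2 \<beta>2 X Y)"
  proof -
    define p q3 q4 s3 t u where "p = w3 (br a (J a))" and "q3 = w3 (br a b)" and "q4 = w3 (br a (J b))"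
      and "s3 = w3 (br (J a) b)" and "t = w3 (br a c)" and "u = w3 (br b (J b))"
    note defs = this
    have i: "w3 (br (J a) (J b)) = q3 + \<i> * s3 + \<i> * q4"
      unfolding integrability[of a b] defs by (simp add: linear_add[OF wlin(3)] wJ)
    define \<beta>1 where "\<beta>1 = (\<lambda>X. - (p * complex_of_real (f2 X) + q3 * complex_of_real (f3 X)
      + q4 * complex_of_real (f4 X) + t * complex_of_real (f5 X)))"
    \<comment> \<open>Beyond \<open>w1 \<and> \<beta>1\<close> there remain, up to sign,
      \<open>s3 - \<i> * q3\<close> on \<open>f2 \<and> f3\<close>, \<open>q3 + \<i> * s3\<close> on
      \<open>f2 \<and> f4\<close> and \<open>u\<close> on \<open>f3 \<and> f4\<close>. The second
      coefficient is \<open>\<i>\<close> times the first, so these two terms form a multiple of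
      \<open>f2 \<and> w2\<close>.\<close>
    define \<beta>2 where "\<beta>2 = (\<lambda>X. - (u * complex_of_real (f4 X) - (s3 - \<i> * q3) * complex_of_real (f2 X)))"
    have "cform1 \<beta>1" "cform1 \<beta>2" unfolding cform1_def \<beta>1_def \<beta>2_def
      by (rule linearI; simp add: f_simps algebra_simps scaleR_conv_of_real)+
    moreover have "d1 br w3 X Y = wedge11 w1 \<beta>1 X Y + wedge11 w2 \<beta>2 X Y" for X Y
      unfolding d1_def
      by (subst bracket_expansion[OF frame])
        (simp add: linear_add[OF wlin(3)] linear_scale[OF wlin(3)] linear_0[OF wlin(3)] comm central Jac wJ i
         flip: defs, simp add: w1 w2 \<beta>1_def \<beta>2_def wedge11_def scaleR_conv_of_real algebra_simps ii)
    ultimately show ?thesis by blast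
  qed
  ultimately show ?thesis
    unfolding good_coframe_def w1[symmetric] w2[symmetric] w3[symmetric] by blast
qed

text \<open>For \<open>i < j\<close> the coefficient of \<open>e i \<and> e j\<close> in the
  differential of \<open>e k\<close> is \<open>- e k\<close> of the bracket of the two frame
  vectors; for \<open>j \<ge> 3\<close> the flag forces it to vanish unless \<open>j < k\<close>.
  The commutation hypotheses remove \<open>e 3 \<and> e 5\<close> and \<open>e 4 \<and> e 5\<close>
  from the differential of \<open>e 6\<close>.\<close>

lemma structure_equations:
  assumes frame: "dual_frame (e 1) (e 2) (e 3) (e 4) (e 5) (e 6) v1 v2 v3 v4 v5 v6"
    and "\<And>X. br X v3 \<in> span {v4, v5, v6}" "\<And>X. br X v4 \<in> span {v5, v6}" "\<And>X. br X v5 \<in> span {v6}"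
    and v6: "\<And>X. br X v6 = 0" and comm: "br v3 v5 = 0" "br v4 v5 = 0"
  shows "in_span2 e {(1,2)} (d1 br (e 3))"
    "in_span2 e {(1,2),(1,3),(2,3)} (d1 br (e 4))"
    "in_span2 e {(1,2),(1,3),(1,4),(2,3),(2,4),(3,4)} (d1 br (e 5))"
    "in_span2 e {(1,2),(1,3),(1,4),(1,5),(2,3),(2,4),(2,5),(3,4)} (d1 br (e 6))"
proof -
  note vals = dual_frame_values[OF frame]
  note lin = dual_frame_linear[OF frame]
  note e_simps = lin[THEN linear_add] lin[THEN linear_scale] lin[THEN linear_0]
  note k = assms(2-4)[THEN linear_eq_0_on_span[rotated 2]]
  have z: "e 3 (br X v3) = 0" "e 3 (br X v4) = 0" "e 3 (br X v5) = 0"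
    "e 4 (br X v4) = 0" "e 4 (br X v5) = 0" "e 5 (br X v5) = 0" for X
    by (rule k; use lin vals in auto)+
  let ?c = "\<lambda>k p. - e k (br ([v1, v2, v3, v4, v5, v6] ! (fst p - 1)) ([v1, v2, v3, v4, v5, v6] ! (snd p - 1)))"
  show "in_span2 e {(1,2)} (d1 br (e 3))"
    unfolding in_span2_def d1_def
    by (rule exI[of _ "?c 3"], intro ext, subst bracket_expansion[OF frame])
      (simp add: e_simps z v6 comm del: One_nat_def)
  show "in_span2 e {(1,2),(1,3),(2,3)} (d1 br (e 4))"
    unfolding in_span2_def d1_def
    by (rule exI[of _ "?c 4"], intro ext, subst bracket_expansion[OF frame])
      (simp add: e_simps z v6 comm algebra_simps del: One_nat_def)
  show "in_span2 e {(1,2),(1,3),(1,4),(2,3),(2,4),(3,4)} (d1 br (e 5))"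
    unfolding in_span2_def d1_def
    by (rule exI[of _ "?c 5"], intro ext, subst bracket_expansion[OF frame])
      (simp add: e_simps z v6 comm algebra_simps del: One_nat_def)
  show "in_span2 e {(1,2),(1,3),(1,4),(1,5),(2,3),(2,4),(2,5),(3,4)} (d1 br (e 6))"
    unfolding in_span2_def d1_def
    by (rule exI[of _ "?c 6"], intro ext, subst bracket_expansion[OF frame])
      (simp add: e_simps z v6 comm algebra_simps del: One_nat_def)
qed

text \<open>Reduces the theorem to a choice of vectors. The alternatives in \<open>J\<close> are
  cases (I) and (II); in the second, \<open>br v3 v4 = 0\<close> supplies the condition
  \<open>br b c = 0\<close> of \<open>good_coframeI\<close>.\<close>

lemma adapted_coframe:
  assumes dim: "DIM('g) = 6" "v6 \<noteq> 0" "v5 \<notin> span {v6}" "v4 \<notin> span {v5, v6}"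
    "v3 \<notin> span {v4, v5, v6}" "v2 \<notin> span {v3, v4, v5, v6}" "v1 \<notin> span {v2, v3, v4, v5, v6}"
    and der: "\<And>X Y. br X Y \<in> span {v3, v4, v5, v6}"
    and flag: "\<And>X. br X v3 \<in> span {v4, v5, v6}" "\<And>X. br X v4 \<in> span {v5, v6}" "\<And>X. br X v5 \<in> span {v6}"
      "\<And>X. br X v6 = 0" and comm: "br v3 v5 = 0" "br v4 v5 = 0"
    and J: "v2 = J v1" "v4 = J v3 \<and> v6 = J v5 \<or> v5 = J v4 \<and> v6 = J v3 \<and> br v3 v4 = 0"
  shows "\<exists>e :: nat \<Rightarrow> 'g \<Rightarrow> real. dual_basis6 e \<and>
    in_span2 e {(1,2)} (d1 br (e 3)) \<and>
    in_span2 e {(1,2),(1,3),(2,3)} (d1 br (e 4)) \<and>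
    in_span2 e {(1,2),(1,3),(1,4),(2,3),(2,4),(3,4)} (d1 br (e 5)) \<and>
    in_span2 e {(1,2),(1,3),(1,4),(1,5),(2,3),(2,4),(2,5),(3,4)} (d1 br (e 6)) \<and>
    (good_coframe br J (cpair e 1 2) (cpair e 3 4) (cpair e 5 6) \<or>
     good_coframe br J (cpair e 1 2) (cpair e 4 5) (cpair e 3 6))"
proof -
  obtain e :: "nat \<Rightarrow> 'g \<Rightarrow> real"
    where frame: "dual_frame (e 1) (e 2) (e 3) (e 4) (e 5) (e 6) v1 v2 v3 v4 v5 v6"
    by (rule dual_frame_exists[OF dim])
  note vals = dual_frame_values[OF frame]
  note lin = dual_frame_linear[OF frame]
  note k = linear_eq_0_on_span[OF _ _ der] flag(1-3)[THEN linear_eq_0_on_span[rotated 2]]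
  have z: "e 1 (br X Y) = 0" "e 2 (br X Y) = 0" "e 3 (br X v3) = 0" "e 3 (br X v4) = 0"
    "e 4 (br X v4) = 0" "e 4 (br X v5) = 0" "e 5 (br X v5) = 0" for X Y
    by (rule k; use lin vals in auto)+
  from J(2) have "good_coframe br J (cpair e 1 2) (cpair e 3 4) (cpair e 5 6) \<or>
     good_coframe br J (cpair e 1 2) (cpair e 4 5) (cpair e 3 6)"
  proof
    assume J': "v4 = J v3 \<and> v6 = J v5"
    have "good_coframe br J (cpair e 1 2) (cpair e 3 4) (cpair e 5 6)"
      unfolding cpair_def
    proof (rule good_coframeI)
      show "dual_frame (e 1) (e 2) (e 3) (e 4) (e 5) (e 6) v1 (J v1) v3 (J v3) v5 (J v5)"
        using frame J J' by simp
    qed (use J' z flag(4) comm in \<open>simp_all del: One_nat_def\<close>)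
    then show ?thesis ..
  next
    assume J': "v5 = J v4 \<and> v6 = J v3 \<and> br v3 v4 = 0"
    have "good_coframe br J (cpair e 1 2) (cpair e 4 5) (cpair e 3 6)"
      unfolding cpair_def
    proof (rule good_coframeI)
      show "dual_frame (e 1) (e 2) (e 4) (e 5) (e 3) (e 6) v1 (J v1) v4 (J v4) v3 (J v3)"
        using dual_frame_permute[OF frame] J(1) J' by simp
      show "br v4 v3 = 0" "br (J v4) v3 = 0"
        using J' comm br_antisym[of _ v3] by auto
    qed (use J' z flag(4) in \<open>simp_all del: One_nat_def\<close>)
    then show ?thesis ..
  qed
  then show ?thesis
    using dual_frame_dual_basis6[OF frame] structure_equations[OF frame flag comm]
    by (intro exI[of _ e] conjI)
qed

section \<open>Adapted bases of \<open>W1\<close>\<close>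

lemma J_notin_line:
  assumes "z \<noteq> 0" shows "J z \<notin> span {z}"
  using J_notin_span[of "{0}" z] assms by (simp add: J_simps insert_commute)

lemma J_mem_iff:
  assumes "subspace S" "\<And>x. x \<in> S \<Longrightarrow> J x \<in> S"
  shows "J x \<in> S \<longleftrightarrow> x \<in> S"
  using assms(2)[of x] assms(2)[of "J x"] subspace_neg[OF assms(1), of "- x"] by auto

lemma J_stable_plane_span:
  assumes "subspace W" "dim W = 2" "z \<in> W" "J z \<in> W" "z \<noteq> 0"
  shows "span {J z, z} = W"
  by (rule span_insert_eq) (use assms J_notin_line span_minimal[of "{z}" W] in auto)

text \<open>\<open>J_notin_span\<close> is applied at \<open>J x\<close>, as
  \<open>J (J x) = - x\<close>. With \<open>x = v1\<close> the conclusions are the independence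
  conditions on \<open>v2 = J v1\<close> and \<open>v1\<close> in
  \<open>adapted_coframe\<close>.\<close>

lemma transversal_vectors:
  assumes W: "subspace W" "\<And>x. x \<in> W \<Longrightarrow> J x \<in> W" "W = span B" "x \<notin> W"
  shows "J x \<notin> span B" "x \<notin> span (insert (J x) B)"
proof -
  have Jx: "J x \<notin> W" using J_mem_iff[OF W(1,2)] W(4) by simp
  then show "J x \<notin> span B" using W(3) by simp
  have "- x \<notin> span (insert (J x) W)" using J_notin_span[OF W(1,2) Jx] by simp
  moreover have "span (insert (J x) B) \<subseteq> span (insert (J x) W)"
    using W(3) span_superset[of B] by (intro span_mono) auto
  ultimately show "x \<notin> span (insert (J x) B)"
    using uminus_mem_iff[OF subspace_span] by blast
qed

text \<open>The ideals \<open>W1\<close>, \<open>W2\<close> are refined to a flag of ideals. The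
  members of odd dimension are not \<open>J\<close>-stable, so each \<open>J\<close>-pair can be
  split between neighbouring steps of the flag.\<close>

lemma adapted_basis_from_plane:
  assumes dim: "DIM('g) = 6"
    and W1: "subspace W1" "\<And>x. x \<in> W1 \<Longrightarrow> J x \<in> W1" "dim W1 = 4" "\<And>x y. br x y \<in> W1"
    and W2: "subspace W2" "\<And>x. x \<in> W2 \<Longrightarrow> J x \<in> W2" "dim W2 = 2" "W2 \<subseteq> W1"
      "\<And>x y. y \<in> W2 \<Longrightarrow> br x y \<in> W2" "\<And>x y. x \<in> W1 \<Longrightarrow> y \<in> W2 \<Longrightarrow> br x y = 0"
  shows "\<exists>v1 v3 v5. v1 \<notin> W1 \<and> W1 = span {v3, J v3, v5, J v5} \<and> J v5 \<noteq> 0 \<and> v5 \<notin> span {J v5} \<and>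
    J v3 \<notin> span {v5, J v5} \<and> v3 \<notin> span {J v3, v5, J v5} \<and>
    (\<forall>X. br X v3 \<in> span {J v3, v5, J v5} \<and> br X (J v3) \<in> span {v5, J v5} \<and>
      br X v5 \<in> span {J v5} \<and> br X (J v5) = 0) \<and> br v3 v5 = 0 \<and> br (J v3) v5 = 0"
proof -
  have s0: "subspace {0::'g}" by simp
  have W2_0: "{0} \<subset> W2" using W2(1,3) subspace_0 by fastforce
  obtain F5 where F5: "subspace F5" "F5 \<subseteq> W2" "dim W2 = Suc (dim F5)" "\<And>x y. y \<in> W2 \<Longrightarrow> br x y \<in> F5"
    by (rule stable_hyperplane[of UNIV "{0}" W2]) (use W2 W2_0 s0 in \<open>auto simp: br_simps\<close>)
  have d5: "dim F5 = 1" using F5 W2 by simp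
  have F5_0: "{0} \<subset> F5" using F5(1) d5 subspace_0 by fastforce
  obtain F6 where F6: "dim F5 = Suc (dim F6)" "\<And>x y. y \<in> F5 \<Longrightarrow> br x y \<in> F6"
    by (rule stable_hyperplane[of UNIV "{0}" F5]) (use F5 F5_0 s0 in \<open>auto simp: br_simps\<close>)
  \<comment> \<open>\<open>F6\<close> has dimension 0, so \<open>F5\<close> is central.\<close>
  have c5: "br x y = 0" if "y \<in> F5" for x y
    using F6(1) F6(2)[OF that, of x] d5 by auto
  have W21: "W2 \<subset> W1" using W1(3) W2(3,4) by auto
  obtain F3 where F3: "subspace F3" "W2 \<subseteq> F3" "F3 \<subseteq> W1" "dim W1 = Suc (dim F3)"
      "\<And>x y. y \<in> W1 \<Longrightarrow> br x y \<in> F3"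
    by (rule stable_hyperplane[of UNIV W2 W1]) (use W1 W2 W21 in auto)
  have d3: "dim F3 = 3" using F3 W1 by simp
  have W23: "W2 \<subset> F3" using d3 W2(3) F3(2) by auto
  obtain F4 where F4: "subspace F4" "W2 \<subseteq> F4" "dim F3 = Suc (dim F4)"
      "\<And>x y. y \<in> F3 \<Longrightarrow> br x y \<in> F4"
    by (rule stable_hyperplane[of UNIV W2 F3]) (use F3 W2 W23 in auto)
  \<comment> \<open>A hyperplane of \<open>F3\<close> containing \<open>W2\<close> is
    \<open>W2\<close> itself, so brackets with \<open>F3\<close> land in \<open>W2\<close>.\<close>
  have "W2 = F4" using F4 W2 d3 by (intro subspace_dim_equal) auto
  obtain z where z: "z \<in> F5" "z \<noteq> 0" using F5_0 by blast
  have zW: "z \<in> W2" "J z \<in> W2" using z F5(2) W2(2) by auto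
  obtain y where y: "y \<in> F3" "y \<notin> W2" using W23 by blast
  \<comment> \<open>The signs make \<open>z\<close> and \<open>y\<close>, the lower vectors of the
    pairs, equal to \<open>J v5\<close> and \<open>J v3\<close>.\<close>
  define v5 v3 where "v5 = - J z" and "v3 = - J y"
  have Jv: "J v5 = z" "J v3 = y" unfolding v5_def v3_def by (simp_all add: J_simps)
  have sp5: "span {z} = F5"
    by (rule span_insert_eq) (use F5 z d5 subspace_0 in auto)
  have v5: "v5 \<notin> span {z}"
    unfolding v5_def using J_notin_line[OF z(2)] uminus_mem_iff[OF subspace_span] by blast
  have sp4: "span {v5, z} = W2"
    by (rule span_insert_eq)
      (use W2 zW v5 sp5 F5 in \<open>auto simp: v5_def intro: subspace_neg\<close>)
  have sp3: "span {y, v5, z} = F3"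
    by (rule span_insert_eq) (use F3 y sp4 d3 W2(3) in auto)
  \<comment> \<open>\<open>F3\<close> is \<open>W2\<close> plus the line of \<open>y\<close>, which
    leaves no room for \<open>J y\<close>.\<close>
  have "J y \<notin> span (insert y W2)" using J_notin_span[OF W2(1,2) y(2)] by simp
  moreover have "span (insert y W2) = F3"
    by (rule span_insert_eq) (use F3 y d3 W2 in \<open>auto simp: span_eq_iff[THEN iffD2]\<close>)
  ultimately have v3: "v3 \<notin> F3" unfolding v3_def using uminus_mem_iff[OF F3(1)] by blast
  have v3W: "v3 \<in> W1" unfolding v3_def using y F3(3) W1(1,2) by (auto intro: subspace_neg)
  have sp2: "span {v3, y, v5, z} = W1"
    by (rule span_insert_eq) (use W1 sp3 v3 v3W d3 F3 in auto)
  have "W1 \<noteq> UNIV" using W1(3) dim by auto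
  then obtain v1 where v1: "v1 \<notin> W1" by blast
  have v5W: "v5 \<in> W2" using sp4 span_base[of v5 "{v5, z}"] by auto
  show ?thesis
  proof (rule exI[of _ v1], rule exI[of _ v3], rule exI[of _ v5], unfold Jv sp2 sp3 sp4 sp5, intro conjI allI)
    show "br X v3 \<in> F3" for X using F3(5) v3W by blast
    show "br X y \<in> W2" for X using F4(4) y \<open>W2 = F4\<close> by blast
    show "br X v5 \<in> F5" for X using F5(4) v5W by blast
    show "br X z = 0" for X using c5 z by blast
    show "br v3 v5 = 0" using W2(6) v3W v5W by blast
    show "br y v5 = 0" using W2(6) v5W y(1) F3(3) by blast
  qed (use v1 z v5 sp5 y v3 in auto)
qed

text \<open>The plane from \<open>J_stable_derived\<close> is central in \<open>W1\<close>, and a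
  nonzero bracket excludes a larger centre. The centre of an ideal is an ideal.\<close>

lemma plane_in_nonabelian:
  assumes W1: "subspace W1" "\<And>x. x \<in> W1 \<Longrightarrow> J x \<in> W1" "dim W1 = 4" "\<And>x y. br x y \<in> W1"
    and nonab: "x0 \<in> W1" "y0 \<in> W1" "br x0 y0 \<noteq> 0"
  obtains W2 where "subspace W2" "\<And>x. x \<in> W2 \<Longrightarrow> J x \<in> W2" "dim W2 = 2" "W2 \<subseteq> W1"
      "\<And>x y. y \<in> W2 \<Longrightarrow> br x y \<in> W2" "\<And>x y. x \<in> W1 \<Longrightarrow> y \<in> W2 \<Longrightarrow> br x y = 0"
proof -
  have s0: "subspace {0::'g}" by simp
  have "W1 \<noteq> {0}" using W1(3) by auto
  then obtain W2 where W2: "subspace W2" "\<And>x. x \<in> W2 \<Longrightarrow> J x \<in> W2" "W2 \<subseteq> W1" "dim W1 = dim W2 + 2"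
    "\<And>x y. x \<in> W1 \<Longrightarrow> y \<in> W1 \<Longrightarrow> br x y \<in> W2"
    using J_stable_derived[OF W1(1,2)] W1(4) by metis
  have d2: "dim W2 = 2" using W2(4) W1(3) by simp
  have W2_0: "{0} \<subset> W2" using W2(1) d2 subspace_0 by fastforce
  \<comment> \<open>Only \<open>W1\<close> acts here, because \<open>W2\<close> is not yet known to
    be an ideal of the whole algebra.\<close>
  obtain F5 where F5: "subspace F5" "F5 \<subseteq> W2" "dim W2 = Suc (dim F5)"
      "\<And>x y. x \<in> W1 \<Longrightarrow> y \<in> W2 \<Longrightarrow> br x y \<in> F5"
    by (rule stable_hyperplane[of W1 "{0}" W2]) (use W2 W2_0 s0 in \<open>auto simp: br_simps\<close>)
  have d5: "dim F5 = 1" using F5 d2 by simp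
  have F5_0: "{0} \<subset> F5" using F5(1) d5 subspace_0 by fastforce
  obtain F6 where F6: "dim F5 = Suc (dim F6)" "\<And>x y. x \<in> W1 \<Longrightarrow> y \<in> F5 \<Longrightarrow> br x y \<in> F6"
    by (rule stable_hyperplane[of W1 "{0}" F5]) (use F5 F5_0 s0 in \<open>auto simp: br_simps\<close>)
  have c5: "br x y = 0" if "x \<in> W1" "y \<in> F5" for x y
    using F6(1) F6(2)[OF that] d5 by auto
  obtain z where z: "z \<in> F5" "z \<noteq> 0" using F5_0 by blast
  have zW: "z \<in> W2" "J z \<in> W2" using z F5(2) W2(2) by auto
  have sp5: "span {z} = F5"
    by (rule span_insert_eq) (use F5 z d5 subspace_0 in auto)
  have sp2: "span {J z, z} = W2" using J_stable_plane_span W2(1) d2 zW z(2) by blast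
  \<comment> \<open>The bracket \<open>br x (J z)\<close> and its image under \<open>J\<close> both
    lie in the line \<open>F5\<close>, which contains no nonzero vector together with its
    image.\<close>
  have Jz: "br x (J z) = 0" if "x \<in> W1" for x
  proof -
    have "br (J x) (J z) = J (br x (J z))"
      using integrability[of x z] c5[OF that z(1)] c5[OF W1(2)[OF that] z(1)] by (simp add: J_simps)
    moreover have "br (J x) (J z) \<in> F5" "br x (J z) \<in> F5" using F5(4) that W1(2) zW by auto
    ultimately have u: "br x (J z) \<in> F5" "J (br x (J z)) \<in> F5" by auto
    then obtain k where k: "br x (J z) = k *\<^sub>R z" using sp5 by (auto simp: span_singleton)
    have "k = 0"
    proof (rule ccontr)
      assume "k \<noteq> 0"
      have "inverse k *\<^sub>R J (br x (J z)) \<in> F5" using u(2) F5(1) by (intro subspace_scale)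
      then have "J z \<in> F5" using \<open>k \<noteq> 0\<close> unfolding k by (simp add: J_simps)
      then show False using J_notin_line[OF z(2)] sp5 by simp
    qed
    then show ?thesis using k by simp
  qed
  have cent: "br x y = 0" if "x \<in> W1" "y \<in> W2" for x y
  proof -
    have "br x y \<in> {0}"
      by (rule br_span[of "W1" "{J z, z}"])
        (use that sp2 Jz c5 z in \<open>auto intro: span_base\<close>)
    then show ?thesis by simp
  qed
  \<comment> \<open>A central vector outside \<open>W2\<close> would, together with its image under \<open>J\<close>, span \<open>W1\<close> modulo \<open>W2\<close>.\<close>
  have centre: "y \<in> W2" if y: "y \<in> W1" "\<And>x. x \<in> W1 \<Longrightarrow> br x y = 0" for y
  proof (rule ccontr)
    assume "y \<notin> W2"
    note D = J_stable_add[OF W2(1,2) this]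
    have sub: "{y, J y} \<union> W2 \<subseteq> W1" using y(1) W1(2) W2(3) by auto
    have "span ({y, J y} \<union> W2) = W1"
      by (rule subspace_dim_equal) (use D W2(4) W1(1) span_minimal[OF sub] in auto)
    moreover have "br s t \<in> {0}" if "s \<in> {y, J y} \<union> W2" "t \<in> {y, J y} \<union> W2" for s t
    proof -
      have st: "s \<in> W1" "t \<in> W1" using that sub by auto
      show ?thesis
        using that y(2)[OF st(1)] y(2)[OF st(2)] cent[OF st(1), of t] cent[OF st(2), of s]
          br_antisym[of s t] br_self by auto
    qed
    ultimately have "br x0 y0 \<in> {0}"
      using br_span[of "{y, J y} \<union> W2" "{y, J y} \<union> W2" "{0}" x0 y0] nonab(1,2) by simp
    then show False using nonab(3) by simp
  qed
  \<comment> \<open>By Jacobi, \<open>br u (br x y)\<close> is a sum of brackets of \<open>y\<close>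
    with elements of \<open>W1\<close>, up to a further bracket with \<open>x\<close>; all vanish as
    \<open>y\<close> is central in \<open>W1\<close>.\<close>
  have ideal: "br x y \<in> W2" if "y \<in> W2" for x y
  proof (rule centre)
    show "br x y \<in> W1" by (rule W1)
    fix u assume u: "u \<in> W1"
    have "br y u = 0" using cent[OF u that] br_antisym[of y u] by simp
    moreover have "br y (br u x) = 0"
      using cent[OF W1(4) that] br_antisym[of y "br u x"] by simp
    ultimately show "br u (br x y) = 0" using jacobi[of u x y] by (simp add: br_simps)
  qed
  show thesis by (rule that[of W2]) (use W2 d2 ideal cent in auto)
qed

text \<open>The question is whether \<open>J z\<close> lies in \<open>F3\<close>, for
  \<open>z\<close> spanning the bottom of a flag of ideals. If not, \<open>J z\<close> completes
  \<open>F3\<close> to \<open>W1\<close>.\<close>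

lemma abelian_dichotomy:
  assumes W1: "subspace W1" "\<And>x. x \<in> W1 \<Longrightarrow> J x \<in> W1" "dim W1 = 4" "\<And>x y. br x y \<in> W1"
    and ab: "\<And>x y. x \<in> W1 \<Longrightarrow> y \<in> W1 \<Longrightarrow> br x y = 0"
  obtains (plane) W2 where "subspace W2" "\<And>x. x \<in> W2 \<Longrightarrow> J x \<in> W2" "dim W2 = 2" "W2 \<subseteq> W1"
      "\<And>x y. y \<in> W2 \<Longrightarrow> br x y \<in> W2"
  | (flag) v3 v4 where "W1 = span {v3, v4, J v4, J v3}" "J v3 \<noteq> 0" "J v4 \<notin> span {J v3}"
      "v4 \<notin> span {J v4, J v3}" "v3 \<notin> span {v4, J v4, J v3}"
      "\<And>X. br X v3 \<in> span {v4, J v4, J v3}" "\<And>X. br X v4 \<in> span {J v4, J v3}"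
      "\<And>X. br X (J v4) \<in> span {J v3}" "\<And>X. br X (J v3) = 0"
proof -
  have s0: "subspace {0::'g}" by simp
  have z0: "{0} \<subset> F" if "subspace F" "dim F = Suc n" for F :: "'g set" and n
    using that subspace_0 by fastforce
  obtain F3 where F3: "subspace F3" "F3 \<subseteq> W1" "dim W1 = Suc (dim F3)" "\<And>x y. y \<in> W1 \<Longrightarrow> br x y \<in> F3"
    by (rule stable_hyperplane[of UNIV "{0}" W1]) (use W1 s0 z0[of W1 3] in \<open>auto simp: br_simps\<close>)
  have d3: "dim F3 = 3" using F3 W1 by simp
  obtain F4 where F4: "subspace F4" "F4 \<subseteq> F3" "dim F3 = Suc (dim F4)" "\<And>x y. y \<in> F3 \<Longrightarrow> br x y \<in> F4"
    by (rule stable_hyperplane[of UNIV "{0}" F3]) (use F3 s0 z0[of F3 2] d3 in \<open>auto simp: br_simps\<close>)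
  have d4: "dim F4 = 2" using F4 d3 by simp
  obtain F5 where F5: "subspace F5" "F5 \<subseteq> F4" "dim F4 = Suc (dim F5)" "\<And>x y. y \<in> F4 \<Longrightarrow> br x y \<in> F5"
    by (rule stable_hyperplane[of UNIV "{0}" F4]) (use F4 s0 z0[of F4 1] d4 in \<open>auto simp: br_simps\<close>)
  have d5: "dim F5 = 1" using F5 d4 by simp
  obtain F6 where F6: "dim F5 = Suc (dim F6)" "\<And>x y. y \<in> F5 \<Longrightarrow> br x y \<in> F6"
    by (rule stable_hyperplane[of UNIV "{0}" F5]) (use F5 s0 z0[of F5 0] d5 in \<open>auto simp: br_simps\<close>)
  have c5: "br x y = 0" if "y \<in> F5" for x y
    using F6(1) F6(2)[OF that, of x] d5 by auto
  obtain z where z: "z \<in> F5" "z \<noteq> 0" using z0[of F5 0] F5 d5 by auto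
  have zW: "z \<in> F4" "z \<in> F3" "z \<in> W1" "J z \<in> W1" using z F5(2) F4(2) F3(2) W1(2) by auto
  have sp5: "span {z} = F5"
    by (rule span_insert_eq) (use F5 z d5 subspace_0 in auto)
  show thesis
  proof (cases "J z \<in> F3")
    case True
    show thesis
    proof (cases "\<forall>x. br x (J z) = 0")
      case True
      have d: "dim (span {J z, z}) = 2"
        using J_notin_line[OF z(2)] z(2) by (simp add: dim_insert)
      have J2: "J x \<in> span {J z, z}" if "x \<in> span {J z, z}" for x
        using J_stable_add(2)[of "{0}" z x] that z(2) by (simp add: J_simps insert_commute)
      have "span {J z, z} \<subseteq> W1" using zW W1(1) by (intro span_minimal) auto
      moreover have "br x y \<in> span {J z, z}" if "y \<in> span {J z, z}" for x y
        by (rule br_span[of "{x}" "{J z, z}"])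
          (use that True c5 z in \<open>auto intro: span_base span_zero\<close>)
      ultimately show thesis using plane[of "span {J z, z}"] d J2 by simp
    next
      case False
      then obtain x where x: "br x (J z) \<noteq> 0" by blast
      \<comment> \<open>As \<open>J z\<close> lies in \<open>F3\<close>, the nonzero vector
        \<open>br x (J z)\<close> and its image \<open>br (J x) (J z)\<close> under \<open>J\<close>
        lie in \<open>F4\<close>, and so span it.\<close>
      have 1: "br x (J z) \<in> F4" "br (J x) (J z) \<in> F4" using F4(4) True by auto
      have 2: "J (br x (J z)) \<in> F4" using 1 br_J_central[of z x] c5 z by simp
      have sp: "span {J (br x (J z)), br x (J z)} = F4"
        using J_stable_plane_span[OF F4(1) d4 1(1) 2 x] .
      have J4: "J y \<in> F4" if "y \<in> F4" for y
        using J_stable_add(2)[of "{0}" "br x (J z)" y] that x sp by (simp add: J_simps insert_commute)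
      show thesis
      proof (rule plane)
        show "br x y \<in> F4" if "y \<in> F4" for x y using F5(2,4) that by blast
      qed (use F4 F3 J4 d4 in auto)
    qed
  next
    case False
    have W1sp: "span (insert (J z) F3) = W1"
      by (rule span_insert_eq) (use F3 W1 False zW in \<open>auto simp: span_eq_iff[THEN iffD2]\<close>)
    have "F5 \<noteq> F4" using d4 d5 by auto
    then obtain y where y: "y \<in> F4" "y \<notin> F5" using F5(2) by blast
    have "J y \<in> span (insert (J z) F3)" unfolding W1sp using y F4(2) F3(2) W1(2) by blast
    then obtain k where k: "J y - k *\<^sub>R J z \<in> F3"
      using F3(1) by (auto simp: span_breakdown_eq span_eq_iff[THEN iffD2])
    \<comment> \<open>Modulo \<open>F3\<close>, \<open>J y\<close> is \<open>k\<close> times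
      \<open>J z\<close>; the correction cancels this component without leaving
      \<open>F4\<close>.\<close>
    define v5 where "v5 = y - k *\<^sub>R z"
    have v5: "v5 \<in> F4" "J v5 \<in> F3"
      using y zW F4(1) k by (auto simp: v5_def J_simps intro: subspace_diff subspace_scale)
    have v5': "v5 \<notin> F5"
    proof
      assume "v5 \<in> F5"
      then have "v5 + k *\<^sub>R z \<in> F5" using z F5(1) by (intro subspace_add subspace_scale)
      then show False using y by (simp add: v5_def)
    qed
    have sp4: "span {v5, z} = F4"
      by (rule span_insert_eq) (use F4 v5 v5' sp5 F5 in auto)
    \<comment> \<open>Otherwise \<open>F4\<close> would be \<open>J\<close>-stable and contain
      \<open>J z\<close>.\<close>
    have Jv5: "J v5 \<notin> F4"
    proof
      assume J: "J v5 \<in> F4"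
      have "v5 \<noteq> 0" using v5' F5(1) subspace_0 by auto
      have "span {J v5, v5} = F4" using J_stable_plane_span[OF F4(1) d4 v5(1) J \<open>v5 \<noteq> 0\<close>] .
      then have "J z \<in> F4"
        using J_stable_add(2)[of "{0}" v5 z] zW(1) \<open>v5 \<noteq> 0\<close> by (simp add: J_simps insert_commute)
      then show False using False F4(2) by blast
    qed
    define v4 v3 where "v4 = - J v5" and "v3 = - J z"
    have Jv: "J v4 = v5" "J v3 = z" unfolding v4_def v3_def by (simp_all add: J_simps)
    have v4: "v4 \<notin> F4" "v4 \<in> F3" "v3 \<notin> F3" "v3 \<in> W1"
      unfolding v4_def v3_def using Jv5 v5 False zW uminus_mem_iff F4(1) F3(1) W1(1) by auto
    have sp3: "span {v4, v5, z} = F3"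
      by (rule span_insert_eq) (use F3 F4 v4 sp4 in auto)
    have sp2: "span {v3, v4, v5, z} = W1"
      by (rule span_insert_eq) (use F3 W1 v4 sp3 in auto)
    show thesis
    proof (rule flag[of v3 v4], unfold Jv sp2 sp3 sp4 sp5)
      show "br X v3 \<in> F3" for X using F3(4) v4 by blast
      show "br X v4 \<in> F4" for X using F4(4) v4 by blast
      show "br X v5 \<in> F5" for X using F5(4) v5 by blast
      show "br X z = 0" for X using c5 z by blast
    qed (use z v5' v4 in auto)
  qed
qed

end

theorem theorem2p5:
  fixes br :: "'g::euclidean_space \<Rightarrow> 'g \<Rightarrow> 'g" and J :: "'g \<Rightarrow> 'g"
  assumes "DIM('g) = 6"
    and "lie_algebra br"
    and "nilpotent_lie br"
    and "complex_structure br J"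
  shows "\<exists>e :: nat \<Rightarrow> 'g \<Rightarrow> real. dual_basis6 e \<and>
    in_span2 e {(1,2)} (d1 br (e 3)) \<and>
    in_span2 e {(1,2),(1,3),(2,3)} (d1 br (e 4)) \<and>
    in_span2 e {(1,2),(1,3),(1,4),(2,3),(2,4),(3,4)} (d1 br (e 5)) \<and>
    in_span2 e {(1,2),(1,3),(1,4),(1,5),(2,3),(2,4),(2,5),(3,4)} (d1 br (e 6)) \<and>
    (good_coframe br J (cpair e 1 2) (cpair e 3 4) (cpair e 5 6) \<or>
     good_coframe br J (cpair e 1 2) (cpair e 4 5) (cpair e 3 6))"
proof -
  interpret nilpotent_complex_lie br J
    using assms by unfold_locales
  have "(UNIV :: 'g set) \<noteq> {0}" 
    by (rule notI, drule arg_cong[where f = dim]) (use assms(1) in simp)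
  then obtain W1 where W1: "subspace W1" "\<And>x. x \<in> W1 \<Longrightarrow> J x \<in> W1" "dim (UNIV :: 'g set) = dim W1 + 2"
    "\<And>x y. br x y \<in> W1"
    using J_stable_derived[of UNIV] by auto
  have d1: "dim W1 = 4" using W1(3) assms(1) by simp
  \<comment> \<open>The nonabelian case and the first abelian alternative both end in a plane, so
    (I) is treated once for both. The other alternative gives the theorem directly through
    (II).\<close>
  have "(\<exists>W2. subspace W2 \<and> (\<forall>x\<in>W2. J x \<in> W2) \<and> dim W2 = 2 \<and> W2 \<subseteq> W1 \<and> (\<forall>x. \<forall>y\<in>W2. br x y \<in> W2) \<and>
      (\<forall>x\<in>W1. \<forall>y\<in>W2. br x y = 0)) \<or> ?thesis"
    (is "?plane \<or> _")
  proof (cases "\<forall>x\<in>W1. \<forall>y\<in>W1. br x y = 0")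
    case False
    then obtain x0 y0 where "x0 \<in> W1" "y0 \<in> W1" "br x0 y0 \<noteq> 0" by blast
    from plane_in_nonabelian[OF W1(1,2) d1 W1(4) this] obtain W2
      where "subspace W2" "\<And>x. x \<in> W2 \<Longrightarrow> J x \<in> W2" "dim W2 = 2" "W2 \<subseteq> W1"
        "\<And>x y. y \<in> W2 \<Longrightarrow> br x y \<in> W2" "\<And>x y. x \<in> W1 \<Longrightarrow> y \<in> W2 \<Longrightarrow> br x y = 0"
      by metis
    then show ?thesis by (intro disjI1 exI[of _ W2]) auto
  next
    case True
    then have ab: "br x y = 0" if "x \<in> W1" "y \<in> W1" for x y using that by blast
    show ?thesis
    proof (rule abelian_dichotomy[OF W1(1,2) d1 W1(4) ab], goal_cases)
      case (4 W2)
      then show ?case using ab by (intro disjI1 exI[of _ W2]) auto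
    next
      case (5 v3 v4)
      have "W1 \<noteq> UNIV" using d1 assms(1) by auto
      then obtain v1 where v1: "v1 \<notin> W1" by blast
      have mem: "v3 \<in> W1" "v4 \<in> W1" "J v4 \<in> W1" unfolding 5(1) by (auto intro: span_base)
      have der: "br X Y \<in> span {v3, v4, J v4, J v3}" for X Y using W1(4) 5(1) by blast
      \<comment> \<open>Case (II), with frame \<open>v1, J v1, v3, v4, J v4, J v3\<close>.\<close>
      show ?case
        by (rule disjI2, rule adapted_coframe[OF assms(1) 5(2-5)
              transversal_vectors[OF W1(1,2) 5(1) v1] der 5(6-9)])
          (use ab mem in auto)
    qed auto
  qed
  then show ?thesis
  proof
    assume ?plane
    then obtain W2 where W2: "subspace W2" "\<forall>x\<in>W2. J x \<in> W2" "dim W2 = 2" "W2 \<subseteq> W1"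
      "\<forall>x. \<forall>y\<in>W2. br x y \<in> W2" "\<forall>x\<in>W1. \<forall>y\<in>W2. br x y = 0"
      by auto
    from adapted_basis_from_plane[OF assms(1) W1(1,2) d1 W1(4) W2(1) _ W2(3,4)] W2(2,5,6)
    obtain v1 v3 v5 where v: "v1 \<notin> W1" "W1 = span {v3, J v3, v5, J v5}" "J v5 \<noteq> 0" "v5 \<notin> span {J v5}"
      "J v3 \<notin> span {v5, J v5}" "v3 \<notin> span {J v3, v5, J v5}"
      "\<And>X. br X v3 \<in> span {J v3, v5, J v5}" "\<And>X. br X (J v3) \<in> span {v5, J v5}"
      "\<And>X. br X v5 \<in> span {J v5}" "\<And>X. br X (J v5) = 0" "br v3 v5 = 0" "br (J v3) v5 = 0"
      by auto
    have der: "br X Y \<in> span {v3, J v3, v5, J v5}" for X Y using W1(4) v(2) by blast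
    \<comment> \<open>Case (I), with frame \<open>v1, J v1, v3, J v3, v5, J v5\<close>.\<close>
    show ?thesis
      by (rule adapted_coframe[OF assms(1) v(3-6) transversal_vectors[OF W1(1,2) v(2,1)] der v(7-12)]) auto
  qed
qed

end
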